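(* Let $n\ge3$ and let $L=(l_1,\dots,l_n)$ be a sequence of pairwise different positive real numbers. (1) The swap action of $F_n$ respects the functions $A$ and $\overrightarrow{S}$: for every $g\in F_n$ and every configuration $P$ of a linkage obtained from $L$ by permuting its entries, one has $A(gP)=A(P)$ if $P\subset\mathbb{R}^2$, and $\overrightarrow{S(gP)}=\overrightarrow{S(P)}$ if $P\subset\mathbb{R}^3$. (2) For $n=4$, the action of $F_4$ respects the volume of the convex hull: for every $g\in F_4$ and every configuration $P\subset\mathbb{R}^3$ of a linkage obtained from $L$ by permuting its entries, $V(\mathrm{Conv}(gP))=V(\mathrm{Conv}(P))$.
   Context: All indices are taken modulo $n$ (so $n+1=1$). For a sequence $L=(l_1,\dots,l_n)$ of positive numbers (a polygonal $n$-linkage), a configuration in $\mathbb{R}^d$ is a sequence of points $P=(p_1,\dots,p_n)$, $p_i\in\mathbb{R}^d$, with $|p_ip_{i+1}|=l_i$ for all $i$. Area functions: the signed area of $P\subset\mathbb{R}^2$ with $p_i=(x_i,y_i)$ is given by $2A(P)=(x_1y_2-x_2y_1)+\dots+(x_ny_1-x_1y_n)$. The vector area of $P\subset\mathbb{R}^3$ is $\overrightarrow{S(P)}$ with $2\overrightarrow{S(P)}=p_1\times p_2+p_2\times p_3+\dots+p_n\times p_1$. $V(\mathrm{Conv}(P))$ denotes the 3-dimensional volume of the convex hull of the vertices of $P$. Swaps ($d\in\{2,3\}$): for a configuration $P$, the polygon $s_i(P)$ is obtained from $P$ by transposing the two edges adjacent to the vertex $p_i$: all vertices other than $p_i$ stay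 fixed, and $p_i$ is replaced by its mirror image in the perpendicular bisector (a line if $d=2$, a plane if $d=3$) of the segment $p_{i-1}p_{i+1}$; so for $d=3$ the new pair of edges lies in the plane spanned by the old pair. (Since the edge lengths are pairwise different, $p_{i-1}\ne p_{i+1}$.) Thus $s_i$ takes a configuration of a linkage to a configuration of the linkage with the two corresponding edge lengths transposed. $F_n$ is the free group on the symbols $s_1,\dots,s_n$; it acts by swaps on the set of all configurations of the linkages obtained from $L$ by permuting its entries. *)

theory Defs
  imports "HOL-Analysis.Analysis" "HOL-Algebra.Group_Action"
begin

section \<open>Free groups\<close>

text \<open>The free group on \<open>X\<close> consists of the reduced words over \<open>X\<close> and its formal inverses: the
  letter \<open>(x, True)\<close> stands for \<open>x\<close>, the letter \<open>(x, False)\<close> for the inverse of \<open>x\<close>.\<close>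

type_synonym 'x word = "('x \<times> bool) list"

definition flip :: "'x \<times> bool \<Rightarrow> 'x \<times> bool" where
  "flip a = (fst a, \<not> snd a)"

definition reduced :: "'x word \<Rightarrow> bool" where
  "reduced w \<longleftrightarrow> successively (\<lambda>a b. b \<noteq> flip a) w"

fun push :: "'x \<times> bool \<Rightarrow> 'x word \<Rightarrow> 'x word" where
  "push a [] = [a]"
| "push a (b # w) = (if b = flip a then w else a # b # w)"

definition reduce :: "'x word \<Rightarrow> 'x word" where
  "reduce w = foldr push w []"

definition free_group :: "'x set \<Rightarrow> 'x word monoid" where
  "free_group X =
    \<lparr>carrier = {w. set w \<subseteq> X \<times> UNIV \<and> reduced w},
     mult = (\<lambda>u v. reduce (u @ v)),
     one = []\<rparr>"

definition gen :: "'x \<Rightarrow> 'x word" where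
  "gen x = [(x, True)]"

text \<open>The homomorphism from the free group to \<open>G\<close> that extends \<open>f\<close>.\<close>

definition free_lift :: "('g, 'b) monoid_scheme \<Rightarrow> ('x \<Rightarrow> 'g) \<Rightarrow> 'x word \<Rightarrow> 'g" where
  "free_lift G f w =
    foldr (\<lambda>(x, e) h. (if e then f x else inv\<^bsub>G\<^esub> (f x)) \<otimes>\<^bsub>G\<^esub> h) w \<one>\<^bsub>G\<^esub>"

lemma flip_flip [simp]: "flip (flip a) = a"
  by (simp add: flip_def)

lemma flip_neq [simp]: "flip a \<noteq> a" "a \<noteq> flip a"
  by (cases a; simp add: flip_def)+

lemma reduced_Nil [simp]: "reduced []"
  by (simp add: reduced_def)

lemma reduced_ConsD: "reduced (a # w) \<Longrightarrow> reduced w"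
  by (cases w) (auto simp: reduced_def)

lemma reduced_push: "reduced w \<Longrightarrow> reduced (push a w)"
  by (cases w) (auto simp: reduced_def dest: reduced_ConsD[unfolded reduced_def])

lemma push_eq_Cons: "reduced (a # w) \<Longrightarrow> push a w = a # w"
  by (cases w) (auto simp: reduced_def)

lemma push_flip: "reduced w \<Longrightarrow> push a (push (flip a) w) = w"
  by (cases w) (auto simp: push_eq_Cons)

lemma reduced_foldr_push: "reduced v \<Longrightarrow> reduced (foldr push u v)"
  by (induction u) (auto intro: reduced_push)

lemma reduced_reduce: "reduced (reduce w)"
  by (simp add: reduce_def reduced_foldr_push)

lemma reduce_id: "reduced w \<Longrightarrow> reduce w = w"
proof (induction w)
  case (Cons a w)
  then show ?case
    using reduced_ConsD[of a w] by (simp add: reduce_def push_eq_Cons)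
qed (simp add: reduce_def)

lemma foldr_push_push: "reduced v \<Longrightarrow> foldr push (push a u) v = push a (foldr push u v)"
proof (cases u)
  case (Cons b w)
  assume "reduced v"
  then show ?thesis
    using Cons push_flip[of "foldr push w v" a] by (auto simp: reduced_foldr_push)
qed auto

lemma foldr_push_reduce: "reduced v \<Longrightarrow> foldr push (reduce u) v = foldr push u v"
  by (induction u) (auto simp: reduce_def foldr_push_push)

lemma reduce_append_reduce [simp]:
  "reduce (reduce u @ v) = reduce (u @ v)" "reduce (u @ reduce v) = reduce (u @ v)"
proof -
  have *: "reduce (u @ v) = foldr push u (reduce v)" for u v :: "'a word"
    by (simp add: reduce_def)
  show "reduce (reduce u @ v) = reduce (u @ v)"
    by (simp add: * foldr_push_reduce reduced_reduce)
  show "reduce (u @ reduce v) = reduce (u @ v)"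
    by (simp add: * reduce_id reduced_reduce)
qed

lemma set_push: "set (push a w) \<subseteq> insert a (set w)"
  by (cases w) auto

lemma set_reduce: "set (reduce w) \<subseteq> set w"
  unfolding reduce_def by (induction w) (use set_push in fastforce)+

lemma reduce_inverse: "reduce (rev (map flip w) @ w) = []"
proof (induction w)
  case (Cons a w)
  have "reduce (rev (map flip (a # w)) @ a # w)
      = reduce (rev (map flip w) @ reduce ([flip a, a] @ w))"
    by simp
  also have "reduce ([flip a, a] @ w) = reduce w"
    using push_flip[of "reduce w" "flip a"] by (simp add: reduce_def reduced_foldr_push)
  finally show ?case
    using Cons by simp
qed (simp add: reduce_def)

lemma group_free_group: "group (free_group X)"
proof (rule groupI)
  fix u assume u: "u \<in> carrier (free_group X)"
  define v where "v = reduce (rev (map flip u))"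
  have "set (rev (map flip u)) \<subseteq> X \<times> UNIV"
    using u by (auto simp: free_group_def flip_def)
  then have "v \<in> carrier (free_group X)"
    using set_reduce[of "rev (map flip u)"] by (auto simp: v_def free_group_def reduced_reduce)
  moreover have "v \<otimes>\<^bsub>free_group X\<^esub> u = \<one>\<^bsub>free_group X\<^esub>"
    by (simp add: v_def free_group_def reduce_inverse)
  ultimately show "\<exists>v\<in>carrier (free_group X). v \<otimes>\<^bsub>free_group X\<^esub> u = \<one>\<^bsub>free_group X\<^esub>"
    by blast
next
  fix u v assume "u \<in> carrier (free_group X)" "v \<in> carrier (free_group X)"
  then show "u \<otimes>\<^bsub>free_group X\<^esub> v \<in> carrier (free_group X)"
    using set_reduce[of "u @ v"] by (auto simp: free_group_def reduced_reduce)
qed (auto simp: free_group_def reduce_id)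

lemma gen_in_free_group: "x \<in> X \<Longrightarrow> gen x \<in> carrier (free_group X)"
  by (simp add: gen_def free_group_def reduced_def)

context
  fixes G :: "('g, 'b) monoid_scheme" and f :: "'x \<Rightarrow> 'g" and X :: "'x set"
  assumes G: "group G" and f: "f \<in> X \<rightarrow> carrier G"
begin

interpretation group G by (rule G)

lemma free_lift_closed: "set w \<subseteq> X \<times> UNIV \<Longrightarrow> free_lift G f w \<in> carrier G"
  using f by (induction w) (auto simp: free_lift_def Pi_iff)

lemma free_lift_append:
  "set u \<subseteq> X \<times> UNIV \<Longrightarrow> set v \<subseteq> X \<times> UNIV \<Longrightarrow>
    free_lift G f (u @ v) = free_lift G f u \<otimes>\<^bsub>G\<^esub> free_lift G f v"
proof (induction u)
  case Nil
  then show ?case using free_lift_closed[of v] by (simp add: free_lift_def)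
next
  case (Cons a u)
  then show ?case
    using free_lift_closed[of u] free_lift_closed[of v] f
    by (cases a) (auto simp: free_lift_def m_assoc Pi_iff)
qed

lemma free_lift_Cons: "free_lift G f ((x, e) # w) = (if e then f x else inv\<^bsub>G\<^esub> f x) \<otimes>\<^bsub>G\<^esub> free_lift G f w"
  by (simp add: free_lift_def)

lemma free_lift_push:
  assumes "set (a # w) \<subseteq> X \<times> UNIV"
  shows "free_lift G f (push a w) = free_lift G f (a # w)"
proof (cases "\<exists>v. w = flip a # v")
  case True
  then obtain v where v: "w = flip a # v" by blast
  obtain x e where a: "a = (x, e)" by fastforce
  have "f x \<in> carrier G" "free_lift G f v \<in> carrier G"
    using assms f v a free_lift_closed[of v] by auto
  then show ?thesis
    by (simp add: v a flip_def free_lift_Cons m_assoc[symmetric])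
next
  case False
  then show ?thesis by (cases w) auto
qed

lemma free_lift_reduce: "set w \<subseteq> X \<times> UNIV \<Longrightarrow> free_lift G f (reduce w) = free_lift G f w"
proof (induction w)
  case (Cons a w)
  have "set (a # reduce w) \<subseteq> X \<times> UNIV"
    using Cons.prems set_reduce[of w] by auto
  from free_lift_push[OF this] show ?case
    using Cons by (cases a) (simp add: reduce_def free_lift_Cons)
qed (simp add: reduce_def)

lemma free_lift_hom: "free_lift G f \<in> hom (free_group X) G"
  by (rule homI) (auto simp: free_group_def free_lift_closed free_lift_append free_lift_reduce)

lemma free_lift_gen: "x \<in> X \<Longrightarrow> free_lift G f (gen x) = f x"
  using f by (auto simp: free_lift_def gen_def Pi_iff)

end


section \<open>Linkages and configurations\<close>

text \<open>Sequences indexed by \<open>1, \<dots>, n\<close> are functions on \<open>nat\<close> of which only the values on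
  \<open>{1..n}\<close> matter; point sequences are required to be extensional, so that two of them are equal
  iff their points are. The cyclic neighbours of an index are \<open>nxt n\<close> and \<open>prv n\<close>.\<close>

definition nxt :: "nat \<Rightarrow> nat \<Rightarrow> nat" where
  "nxt n i = (if i = n then 1 else i + 1)"

definition prv :: "nat \<Rightarrow> nat \<Rightarrow> nat" where
  "prv n i = (if i = 1 then n else i - 1)"

definition configs :: "nat \<Rightarrow> (nat \<Rightarrow> real) \<Rightarrow> (nat \<Rightarrow> 'a::euclidean_space) set" where
  "configs n l = {P \<in> {1..n} \<rightarrow>\<^sub>E UNIV. \<forall>i\<in>{1..n}. dist (P i) (P (nxt n i)) = l i}"

definition all_configs :: "nat \<Rightarrow> (nat \<Rightarrow> real) \<Rightarrow> (nat \<Rightarrow> 'a::euclidean_space) set" where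
  "all_configs n L = (\<Union>\<pi>\<in>{\<pi>. \<pi> permutes {1..n}}. configs n (L \<circ> \<pi>))"

definition signed_area :: "nat \<Rightarrow> (nat \<Rightarrow> real^2) \<Rightarrow> real" where
  "signed_area n P =
    (\<Sum>i=1..n. P i $ 1 * P (nxt n i) $ 2 - P (nxt n i) $ 1 * P i $ 2) / 2"

definition vector_area :: "nat \<Rightarrow> (nat \<Rightarrow> real^3) \<Rightarrow> real^3" where
  "vector_area n P = (1/2) *\<^sub>R (\<Sum>i=1..n. cross3 (P i) (P (nxt n i)))"

definition hull_volume :: "nat \<Rightarrow> (nat \<Rightarrow> real^3) \<Rightarrow> real" where
  "hull_volume n P = measure lebesgue (convex hull (P ` {1..n}))"


section \<open>Swaps\<close>

text \<open>The mirror image of \<open>x\<close> in the perpendicular bisector of the segment \<open>ab\<close>, that is, in the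
  hyperplane through \<open>midpoint a b\<close> with normal \<open>b - a\<close>. If \<open>a = b\<close> the value is \<open>x\<close>.\<close>

definition mirror :: "'a \<Rightarrow> 'a \<Rightarrow> 'a \<Rightarrow> 'a::euclidean_space" where
  "mirror a b x =
    x - (2 * ((x - midpoint a b) \<bullet> (b - a)) / ((b - a) \<bullet> (b - a))) *\<^sub>R (b - a)"

lemma dist_eq_iff_inner_midpoint:
  "dist x a = dist x b \<longleftrightarrow> (x - midpoint a b) \<bullet> (b - a) = 0" for a :: "'a::euclidean_space"
proof -
  have "dist x a = dist x b \<longleftrightarrow> (dist x a)\<^sup>2 = (dist x b)\<^sup>2"
    by (simp add: power2_eq_iff_nonneg)
  also have "\<dots> \<longleftrightarrow> (dist x a)\<^sup>2 - (dist x b)\<^sup>2 = 0"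
    by simp
  also have "(dist x a)\<^sup>2 - (dist x b)\<^sup>2 = 2 * ((x - midpoint a b) \<bullet> (b - a))"
    by (simp add: dist_norm power2_norm_eq_inner midpoint_def inner_simps inner_commute field_simps)
  also have "\<dots> = 0 \<longleftrightarrow> (x - midpoint a b) \<bullet> (b - a) = 0"
    by simp
  finally show ?thesis by simp
qed

lemma mirror_same [simp]: "mirror a a x = x"
  by (simp add: mirror_def)

lemma mirror_bisector: "dist x a = dist x b \<Longrightarrow> mirror a b x = x"
  by (simp add: mirror_def dist_eq_iff_inner_midpoint)

lemma inner_mirror:
  "(mirror a b x - midpoint a b) \<bullet> (b - a) = - ((x - midpoint a b) \<bullet> (b - a))"
proof (cases "a = b")
  case False
  then have "(b - a) \<bullet> (b - a) \<noteq> 0" by simp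
  moreover have "mirror a b x - midpoint a b = (x - midpoint a b)
      - (2 * ((x - midpoint a b) \<bullet> (b - a)) / ((b - a) \<bullet> (b - a))) *\<^sub>R (b - a)"
    by (simp add: mirror_def)
  ultimately show ?thesis
    by (simp only: inner_diff_left[of "x - midpoint a b"] inner_scaleR_left) simp
qed simp

lemma midpoint_mirror_in_bisector:
  "dist (midpoint x (mirror a b x)) a = dist (midpoint x (mirror a b x)) b"
proof -
  have "midpoint x y - m = (1/2) *\<^sub>R ((x - m) + (y - m))" for x y m :: 'a
    by (simp add: midpoint_def algebra_simps flip: scaleR_left.add)
  then show ?thesis
    by (simp add: dist_eq_iff_inner_midpoint inner_add_left inner_mirror
        del: add_diff_eq diff_add_eq)
qed

lemma mirror_mirror [simp]: "mirror a b (mirror a b x) = x"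
proof -
  have "mirror a b (mirror a b x) = mirror a b x
      - (2 * ((mirror a b x - midpoint a b) \<bullet> (b - a)) / ((b - a) \<bullet> (b - a))) *\<^sub>R (b - a)"
    by (simp only: mirror_def[of a b "mirror a b x"])
  also have "\<dots> = x"
    by (simp only: inner_mirror) (simp add: mirror_def)
  finally show ?thesis .
qed

lemma dist_mirror_mirror: "dist (mirror a b x) (mirror a b y) = dist x y"
proof (cases "a = b")
  case False
  define u where "u = b - a"
  define v where "v = x - y"
  define k where "k z = 2 * ((z - midpoint a b) \<bullet> u) / (u \<bullet> u)" for z
  define c where "c = k x - k y"
  have u: "u \<bullet> u \<noteq> 0" using False by (simp add: u_def)
  have "k x - k y = 2 * ((x - midpoint a b) \<bullet> u - (y - midpoint a b) \<bullet> u) / (u \<bullet> u)"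
    by (simp add: k_def diff_divide_distrib)
  also have "(x - midpoint a b) \<bullet> u - (y - midpoint a b) \<bullet> u = v \<bullet> u"
    by (simp add: v_def flip: inner_diff_left)
  finally have c: "c * (u \<bullet> u) = 2 * (v \<bullet> u)"
    using u by (simp add: c_def)
  have "mirror a b z = z - k z *\<^sub>R u" for z
    by (simp add: mirror_def k_def u_def)
  then have "mirror a b x - mirror a b y = v - c *\<^sub>R u"
    by (simp add: v_def c_def scaleR_left_diff_distrib)
  moreover have "(v - c *\<^sub>R u) \<bullet> (v - c *\<^sub>R u) = v \<bullet> v - 2 * c * (v \<bullet> u) + c * (c * (u \<bullet> u))"
    by (simp add: inner_diff_left inner_diff_right inner_commute[of u v] algebra_simps)
  ultimately show ?thesis
    by (simp add: dist_norm norm_eq_sqrt_inner c v_def)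
qed simp

lemma mirror_left [simp]: "mirror a b a = b"
proof (cases "a = b")
  case False
  have "a - midpoint a b = (- 1/2) *\<^sub>R (b - a)"
    by (simp add: midpoint_def algebra_simps flip: scaleR_left.add)
  then show ?thesis using False by (simp add: mirror_def)
qed simp

lemma mirror_right [simp]: "mirror a b b = a"
  by (metis mirror_left mirror_mirror)

definition swap :: "nat \<Rightarrow> nat \<Rightarrow> (nat \<Rightarrow> 'a::euclidean_space) \<Rightarrow> nat \<Rightarrow> 'a" where
  "swap n i P = P(i := mirror (P (prv n i)) (P (nxt n i)) (P i))"

text \<open>The (left) action of the free group on \<open>{1..n}\<close> in which the generator \<open>i\<close> acts by
  \<open>swap n i\<close>.\<close>

definition swap_action ::
  "nat \<Rightarrow> (nat \<Rightarrow> real) \<Rightarrow> nat word \<Rightarrow> (nat \<Rightarrow> 'a::euclidean_space) \<Rightarrow> nat \<Rightarrow> 'a" where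
  "swap_action n L =
    free_lift (BijGroup (all_configs n L)) (\<lambda>i. restrict (swap n i) (all_configs n L))"

lemma swap_swap: "2 \<le> n \<Longrightarrow> i \<in> {1..n} \<Longrightarrow> swap n i (swap n i P) = P"
  by (auto simp: swap_def nxt_def prv_def fun_eq_iff)

lemma swap_configs:
  assumes n: "2 \<le> n" and i: "i \<in> {1..n}" and P: "P \<in> configs n l"
  shows "swap n i P \<in> configs n (l \<circ> Transposition.transpose (prv n i) i)"
proof -
  let ?a = "P (prv n i)" and ?b = "P (nxt n i)"
  have d: "dist (P j) (P (nxt n j)) = l j" if "j \<in> {1..n}" for j
    using P that by (simp add: configs_def)
  have ix: "prv n i \<in> {1..n}" "nxt n (prv n i) = i" "prv n i \<noteq> i" "nxt n i \<noteq> i"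
    using n i by (auto simp: prv_def nxt_def)
  have "dist ?a (mirror ?a ?b (P i)) = dist ?b (P i)"
    using dist_mirror_mirror[of ?a ?b ?b "P i"] by simp
  then have 1: "dist ?a (mirror ?a ?b (P i)) = l i"
    using d[OF i] by (simp add: dist_commute)
  have "dist (mirror ?a ?b (P i)) ?b = dist (P i) ?a"
    using dist_mirror_mirror[of ?a ?b "P i" ?a] by simp
  then have 2: "dist (mirror ?a ?b (P i)) ?b = l (prv n i)"
    using d[OF ix(1)] ix(2) by (simp add: dist_commute)
  have "dist (swap n i P j) (swap n i P (nxt n j)) = l (Transposition.transpose (prv n i) i j)"
    if j: "j \<in> {1..n}" for j
  proof -
    consider "j = i" | "j = prv n i" | "j \<noteq> i" "j \<noteq> prv n i" by blast
    then show ?thesis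
    proof cases
      case 3
      then have "nxt n j \<noteq> i" using n i j by (auto simp: prv_def nxt_def split: if_splits)
      with 3 show ?thesis using d[OF j] by (simp add: swap_def)
    qed (use 1 2 ix in \<open>auto simp: swap_def\<close>)
  qed
  moreover have "swap n i P \<in> {1..n} \<rightarrow>\<^sub>E UNIV"
    using P i by (auto simp: configs_def swap_def PiE_def extensional_def)
  ultimately show ?thesis by (simp add: configs_def)
qed

lemma swap_all_configs:
  assumes n: "2 \<le> n" and i: "i \<in> {1..n}" and P: "P \<in> all_configs n L"
  shows "swap n i P \<in> all_configs n L"
proof -
  obtain \<pi> where \<pi>: "\<pi> permutes {1..n}" "P \<in> configs n (L \<circ> \<pi>)"
    using P by (auto simp: all_configs_def)
  let ?t = "Transposition.transpose (prv n i) i"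
  have "?t permutes {1..n}"
    using n i by (intro permutes_swap_id) (auto simp: prv_def)
  with \<pi>(1) have "(\<pi> \<circ> ?t) permutes {1..n}"
    by (rule permutes_compose[rotated])
  moreover have "swap n i P \<in> configs n (L \<circ> (\<pi> \<circ> ?t))"
    using swap_configs[OF n i \<pi>(2)] by (simp add: o_assoc)
  ultimately show ?thesis by (auto simp: all_configs_def)
qed

lemma swap_in_BijGroup:
  assumes "2 \<le> n" "i \<in> {1..n}"
  shows "restrict (swap n i) (all_configs n L) \<in> carrier (BijGroup (all_configs n L))"
proof -
  have "bij_betw (swap n i) (all_configs n L) (all_configs n L)"
    by (rule bij_betw_byWitness[where f' = "swap n i"])
      (use swap_swap[OF assms] swap_all_configs[OF assms] in auto)
  then show ?thesis by (simp add: BijGroup_def Bij_def)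
qed

lemma swap_Pi_BijGroup:
  "2 \<le> n \<Longrightarrow>
    (\<lambda>i. restrict (swap n i) (all_configs n L)) \<in> {1..n} \<rightarrow> carrier (BijGroup (all_configs n L))"
  by (intro Pi_I swap_in_BijGroup)

theorem group_action_swap_action:
  assumes "2 \<le> n"
  shows "group_action (free_group {1..n}) (all_configs n L) (swap_action n L)"
  using free_lift_hom[OF group_BijGroup swap_Pi_BijGroup[OF assms]]
  by (simp add: swap_action_def group_action_def group_hom_def group_hom_axioms_def
      group_free_group group_BijGroup)

theorem swap_action_gen:
  fixes P :: "nat \<Rightarrow> 'a::euclidean_space"
  assumes "2 \<le> n" "i \<in> {1..n}" "P \<in> all_configs n L"
  shows "swap_action n L (gen i) P = swap n i P"
proof -
  have "swap_action n L (gen i) = restrict (swap n i) (all_configs n L :: (nat \<Rightarrow> 'a) set)"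
    unfolding swap_action_def
    using assms(2) by (rule free_lift_gen[OF group_BijGroup swap_Pi_BijGroup[OF assms(1)]])
  then show ?thesis using assms(3) by simp
qed

end

theory Submission
  imports Defs
begin

text \<open>A swap moves the vertex \<open>p\<^sub>i\<close> by a multiple of the diagonal from \<open>p\<^bsub>i-1\<^esub>\<close> to \<open>p\<^bsub>i+1\<^esub>\<close>. Both
  area functions are cyclic sums of an alternating bilinear form, in which such a displacement
  cancels. For \<open>n = 4\<close> the hull is a simplex, possibly degenerate, whose volume is proportional
  to the absolute value of a determinant; there the displacement is a column operation.\<close>

text \<open>Invariance under the generators suffices: a group element acts letter by letter, and an
  inverse letter acts by the same swap as the letter itself.\<close>

lemma swap_action_invariant:
  fixes P :: "nat \<Rightarrow> 'a::euclidean_space"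
  assumes n: "2 \<le> n"
    and inv: "\<And>i Q. i \<in> {1..n} \<Longrightarrow> Q \<in> all_configs n L \<Longrightarrow> f (swap n i Q) = f Q"
    and g: "g \<in> carrier (free_group {1..n})" and P: "P \<in> all_configs n L"
  shows "f (swap_action n L g P) = f P"
proof -
  let ?S = "all_configs n L :: (nat \<Rightarrow> 'a) set"
  let ?h = "\<lambda>i. restrict (swap n i) ?S"
  interpret G: group "BijGroup ?S" by (rule group_BijGroup)
  have hom: "?h \<in> {1..n} \<rightarrow> carrier (BijGroup ?S)"
    using n by (rule swap_Pi_BijGroup)
  have closed: "swap n i Q \<in> ?S" if "i \<in> {1..n}" "Q \<in> ?S" for i Q
    using n that by (rule swap_all_configs)
  \<comment> \<open>Swaps are involutions, so the letters \<open>(i, True)\<close> and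
    \<open>(i, False)\<close> give the same map.\<close>
  have inv_h: "inv\<^bsub>BijGroup ?S\<^esub> ?h i = ?h i" if "i \<in> {1..n}" for i
  proof (rule G.inv_equality)
    show "?h i \<otimes>\<^bsub>BijGroup ?S\<^esub> ?h i = \<one>\<^bsub>BijGroup ?S\<^esub>"
      using Pi_mem[OF hom that] closed[OF that] swap_swap[OF n that]
      by (auto simp: BijGroup_def compose_def intro!: restrict_ext)
  qed (use Pi_mem[OF hom that] in auto)
  \<comment> \<open>Membership in \<open>?S\<close> is carried through the induction because
    \<open>inv\<close> speaks only of configurations in \<open>?S\<close>, and \<open>?h i\<close>
    agrees with the swap only there.\<close>
  have "swap_action n L w P \<in> ?S \<and> f (swap_action n L w P) = f P" if "set w \<subseteq> {1..n} \<times> UNIV" for w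
    using that
  proof (induction w)
    case Nil
    then show ?case using P by (simp add: swap_action_def free_lift_def BijGroup_def)
  next
    case (Cons a w)
    obtain i e where a: "a = (i, e)" by fastforce
    have i: "i \<in> {1..n}" and w: "set w \<subseteq> {1..n} \<times> UNIV" using Cons.prems a by auto
    let ?Q = "swap_action n L w P"
    have "swap_action n L (a # w) = ?h i \<otimes>\<^bsub>BijGroup ?S\<^esub> swap_action n L w"
      using inv_h[OF i] by (simp add: swap_action_def free_lift_def a)
    moreover have "swap_action n L w \<in> carrier (BijGroup ?S)"
      unfolding swap_action_def by (rule free_lift_closed[OF group_BijGroup hom w])
    ultimately have "swap_action n L (a # w) P = swap n i ?Q"
      using Pi_mem[OF hom i] P Cons.IH[OF w] by (simp add: BijGroup_def compose_def)
    then show ?case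
      using Cons.IH[OF w] inv[OF i] closed[OF i] by simp
  qed
  then show ?thesis using g by (auto simp: free_group_def)
qed

lemma mirror_displacement: "\<exists>t. mirror a b x = x + t *\<^sub>R (b - a)"
  by (rule exI[of _ "- (2 * ((x - midpoint a b) \<bullet> (b - a)) / ((b - a) \<bullet> (b - a)))"])
    (simp add: mirror_def)

text \<open>Let p be the moved vertex with neighbours a and b. Only F(a,p) + F(p,b) involves p.
  Moving p by t(b - a) adds t F(a, b - a) + t F(b - a, b), which is t F(a,b) - t F(a,b) = 0 because
  F vanishes on the diagonal.\<close>

lemma cyclic_sum_swap:
  fixes F :: "'a::euclidean_space \<Rightarrow> 'a \<Rightarrow> 'b::real_vector"
  assumes n: "2 \<le> n" and i: "i \<in> {1..n}"
    and F: "bilinear F" and alt: "\<And>u. F u u = 0"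
  shows "(\<Sum>j=1..n. F (swap n i P j) (swap n i P (nxt n j))) = (\<Sum>j=1..n. F (P j) (P (nxt n j)))"
proof -
  let ?k = "prv n i" and ?Q = "swap n i P"
  let ?a = "P ?k" and ?b = "P (nxt n i)"
  obtain t where t: "mirror ?a ?b (P i) = P i + t *\<^sub>R (?b - ?a)"
    using mirror_displacement by blast
  have ix: "?k \<in> {1..n}" "nxt n ?k = i" "?k \<noteq> i" "nxt n i \<noteq> i"
    using n i by (auto simp: prv_def nxt_def)
  \<comment> \<open>The two edges at the moved vertex are those with indices \<open>?k\<close> and
    \<open>i\<close>.\<close>
  have split: "(\<Sum>j=1..n. f j) = f ?k + f i + (\<Sum>j\<in>{1..n} - {?k, i}. f j)" for f :: "nat \<Rightarrow> 'b"
  proof -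
    have "(\<Sum>j=1..n. f j) = sum f ({1..n} - {?k, i}) + sum f {?k, i}"
      using ix i by (intro sum.subset_diff) auto
    then show ?thesis using ix by simp
  qed
  have rest: "(\<Sum>j\<in>{1..n} - {?k, i}. F (?Q j) (?Q (nxt n j)))
      = (\<Sum>j\<in>{1..n} - {?k, i}. F (P j) (P (nxt n j)))"
  proof (rule sum.cong)
    fix j assume j: "j \<in> {1..n} - {?k, i}"
    then have "nxt n j \<noteq> i" using n i by (auto simp: prv_def nxt_def split: if_splits)
    then show "F (?Q j) (?Q (nxt n j)) = F (P j) (P (nxt n j))"
      using j by (simp add: swap_def)
  qed simp
  have "F (?Q ?k) (?Q (nxt n ?k)) + F (?Q i) (?Q (nxt n i))
      = F (P ?k) (P (nxt n ?k)) + F (P i) (P (nxt n i))"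
    using ix by (simp add: swap_def t bilinear_ladd[OF F] bilinear_radd[OF F] bilinear_lmul[OF F]
        bilinear_rmul[OF F] bilinear_lsub[OF F] bilinear_rsub[OF F] alt)
  then show ?thesis by (simp only: split rest)
qed

lemma signed_area_swap:
  assumes "2 \<le> n" "i \<in> {1..n}"
  shows "signed_area n (swap n i P) = signed_area n P"
proof -
  \<comment> \<open>The summand is the determinant of the pair \<open>u\<close>, \<open>v\<close>,
    hence alternating.\<close>
  have "bilinear (\<lambda>u v :: real^2. u $ 1 * v $ 2 - v $ 1 * u $ 2)"
    unfolding bilinear_def linear_iff by (simp add: algebra_simps)
  from cyclic_sum_swap[OF assms this] show ?thesis
    by (simp add: signed_area_def)
qed

lemma vector_area_swap:
  assumes "2 \<le> n" "i \<in> {1..n}"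
  shows "vector_area n (swap n i P) = vector_area n P"
proof -
  have "bilinear cross3"
    unfolding bilinear_def linear_iff
    by (simp add: cross_add_left cross_add_right cross_mult_left cross_mult_right)
  from cyclic_sum_swap[OF assms this] show ?thesis
    by (simp add: vector_area_def)
qed

text \<open>The tetrahedron is the image of the standard simplex under an affine map whose linear
  part has the edge vectors at \<open>a\<close> as columns. The volume of the standard simplex stays
  as an unevaluated constant. A singular linear part is allowed, so flat tetrahedra are
  covered.\<close>

lemma measure_tetrahedron:
  fixes a b c d :: "real^3"
  shows "measure lebesgue (convex hull {a, b, c, d}) =
    \<bar>det (transpose (vector [b - a, c - a, d - a]))\<bar> *
      measure lebesgue (convex hull ({0, axis 1 1, axis 2 1, axis 3 1} :: (real^3) set))"
proof -
  \<comment> \<open>\<open>vector\<close> lists the rows; transposing turns the edge vectors into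
    columns, the images of the axis vectors.\<close>
  define A :: "real^3^3" where "A = transpose (vector [b - a, c - a, d - a])"
  let ?T = "{0, axis 1 1, axis 2 1, axis 3 1} :: (real^3) set"
  have ax: "A *v axis 1 1 = b - a" "A *v axis 2 1 = c - a" "A *v axis 3 1 = d - a"
    by (simp_all add: column_def transpose_def
        matrix_vector_mult_basis vec_eq_iff A_def vector_3)
  have "{a, b, c, d} = (+) a ` (*v) A ` ?T"
    by (simp add: ax)
  then have "convex hull {a, b, c, d} = (+) a ` (convex hull ((*v) A ` ?T))"
    by (metis convex_hull_translation)
  also have "\<dots> = (+) a ` (*v) A ` (convex hull ?T)"
    by (simp only: convex_hull_linear_image[OF matrix_vector_mul_linear])
  finally have "measure lebesgue (convex hull {a, b, c, d})
      = measure lebesgue ((*v) A ` (convex hull ?T))"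
    by (simp only: measure_translation)
  also have "\<dots> = \<bar>det A\<bar> * measure lebesgue (convex hull ?T)"
    by (subst measure_linear_image)
      (auto intro!: lmeasurable_compact finite_imp_compact_convex_hull)
  finally show ?thesis by (simp only: A_def)
qed

text \<open>The displacement adds \<open>t\<close> times the first column to the third, which
  preserves the determinant.\<close>

lemma measure_tetrahedron_shear:
  fixes a b c x :: "real^3"
  shows "measure lebesgue (convex hull {a, b, c, x + t *\<^sub>R (b - a)})
    = measure lebesgue (convex hull {a, b, c, x})"
proof -
  have "det (transpose (vector [b - a, c - a, x + t *\<^sub>R (b - a) - a]))
      = det (transpose (vector [b - a, c - a, x - a]) :: real^3^3)"
    by (simp add: det_3 transpose_def vector_3 algebra_simps)
  then show ?thesis
    by (simp only: measure_tetrahedron[of a b c])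
qed

lemma hull_volume_swap:
  assumes i: "i \<in> {1..4}"
  shows "hull_volume 4 (swap 4 i P) = hull_volume 4 P"
proof -
  \<comment> \<open>\<open>?c\<close> is the vertex opposite to the moved one. Listing the
    neighbours first and the moved vertex last matches the shear.\<close>
  let ?a = "P (prv 4 i)" and ?b = "P (nxt 4 i)" and ?c = "P (nxt 4 (nxt 4 i))"
  have "i = 1 \<or> i = 2 \<or> i = 3 \<or> i = 4" using i by auto
  then have "{1..4} = {prv 4 i, nxt 4 i, nxt 4 (nxt 4 i), i}"
    by (elim disjE) (auto simp: prv_def nxt_def)
  then have Q: "Q ` {1..4} = {Q (prv 4 i), Q (nxt 4 i), Q (nxt 4 (nxt 4 i)), Q i}"
    for Q :: "nat \<Rightarrow> real^3"
    by simp
  obtain t where "mirror ?a ?b (P i) = P i + t *\<^sub>R (?b - ?a)"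
    using mirror_displacement by blast
  moreover have "prv 4 i \<noteq> i" "nxt 4 i \<noteq> i" "nxt 4 (nxt 4 i) \<noteq> i"
    using i by (auto simp: prv_def nxt_def)
  ultimately show ?thesis
    unfolding hull_volume_def Q by (simp add: swap_def measure_tetrahedron_shear)
qed

theorem lemma3p2:
  fixes n :: nat and L :: "nat \<Rightarrow> real"
  assumes "n \<ge> 3"
    and "\<forall>i\<in>{1..n}. L i > 0"
    and "inj_on L {1..n}"
  shows "(\<forall>g\<in>carrier (free_group {1..n}).
            (\<forall>P\<in>all_configs n L. signed_area n (swap_action n L g P) = signed_area n P) \<and>
            (\<forall>P\<in>all_configs n L. vector_area n (swap_action n L g P) = vector_area n P)) \<and>
         (n = 4 \<longrightarrow>
            (\<forall>g\<in>carrier (free_group {1..n}).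
              \<forall>P\<in>all_configs n L. hull_volume n (swap_action n L g P) = hull_volume n P))"
proof -
  have n: "2 \<le> n" using assms(1) by simp
  show ?thesis
    using swap_action_invariant[OF n, of L "signed_area n"] signed_area_swap[OF n]
      swap_action_invariant[OF n, of L "vector_area n"] vector_area_swap[OF n]
      swap_action_invariant[OF n, of L "hull_volume n"] hull_volume_swap
    by blast
qed

end
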